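(* Let $\varrho$ be an aperiodic, primitive, bijective substitution of constant length $L$ with $\varrho_0=\mathrm{id}$, and let $G$ be the group generated by the columns of $\varrho$. Then any fixed point $w$ of $\varrho$ satisfies, for every $k\geqslant 1$, $$L^{k}\leqslant A_w\left(\frac{L^{k|G|}-1}{L^k-1}\right)<\infty .$$
   Context: $\mathbb{N}=\mathbb{Z}_{\geqslant 0}$. A substitution on a finite alphabet $\mathcal{A}$ is a map $\varrho\colon\mathcal{A}\to\mathcal{A}^+$, extended to words by concatenation. It has constant length $L$ if $|\varrho(a)|=L$ for all $a$; its $i$-th column ($0\leqslant i\leqslant L-1$) is the map $\varrho_i\colon\mathcal{A}\to\mathcal{A}$ sending $a$ to the $i$-th letter of $\varrho(a)$ (indices from $0$). It is bijective if every column is a bijection. It is primitive if some power $\varrho^n$ is such that every $\varrho^n(a)$ contains all letters. A fixed point is $w\in\mathcal{A}^{\mathbb{N}}$ with $\varrho(w)=w$; $\varrho$ is aperiodic if it has no fixed point of the form $v^\infty$ with $v$ a finite word. $G$ is the subgroup of the symmetric group on $\mathcal{A}$ generated by $\varrho_0,\dots,\varrho_{L-1}$. For $w\in\mathcal{A}^{\mathbb{N}}$ and $d\geqslant1$, $A_w(d)$ is the maximum (supremum, in $\mathbb{N}\cup\{\infty\}$) of all $M$ such that there is $j\in\mathbb{N}$ with $w_j=w_{j+dn}$ for all $0\leqslant n\leqslant M-1$. *)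

theory Defs
  imports
    "HOL-Algebra.Bij"
    "HOL-Algebra.Generated_Groups"
    "HOL-Library.Omega_Words_Fun"
    "HOL-Library.Extended_Nat"
begin

definition substitution :: "('a \<Rightarrow> 'a list) \<Rightarrow> bool" where
  "substitution \<rho> \<longleftrightarrow> (\<forall>a. \<rho> a \<noteq> [])"

definition subst_list :: "('a \<Rightarrow> 'a list) \<Rightarrow> 'a list \<Rightarrow> 'a list" where
  "subst_list \<rho> u = concat (map \<rho> u)"

text \<open>
  On infinite words: as no image is empty, the image of the first \<open>n + 1\<close> letters
  has length at least \<open>n + 1\<close>, so letter \<open>n\<close> of the infinite concatenation can be read off it.
  That this is the infinite concatenation is \<open>prefix_subst_word\<close> below.
\<close>

definition subst_word :: "('a \<Rightarrow> 'a list) \<Rightarrow> 'a word \<Rightarrow> 'a word" where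
  "subst_word \<rho> w = (\<lambda>n. subst_list \<rho> (prefix (Suc n) w) ! n)"

definition fixed_point :: "('a \<Rightarrow> 'a list) \<Rightarrow> 'a word \<Rightarrow> bool" where
  "fixed_point \<rho> w \<longleftrightarrow> subst_word \<rho> w = w"

definition constant_length :: "('a \<Rightarrow> 'a list) \<Rightarrow> nat \<Rightarrow> bool" where
  "constant_length \<rho> L \<longleftrightarrow> (\<forall>a. length (\<rho> a) = L)"

definition column :: "('a \<Rightarrow> 'a list) \<Rightarrow> nat \<Rightarrow> 'a \<Rightarrow> 'a" where
  "column \<rho> i = (\<lambda>a. \<rho> a ! i)"

definition bijective_subst :: "('a \<Rightarrow> 'a list) \<Rightarrow> nat \<Rightarrow> bool" where
  "bijective_subst \<rho> L \<longleftrightarrow> constant_length \<rho> L \<and> (\<forall>i<L. bij (column \<rho> i))"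

definition primitive :: "('a \<Rightarrow> 'a list) \<Rightarrow> bool" where
  "primitive \<rho> \<longleftrightarrow> (\<exists>n\<ge>1. \<forall>a. set ((subst_list \<rho> ^^ n) [a]) = UNIV)"

definition aperiodic :: "('a \<Rightarrow> 'a list) \<Rightarrow> bool" where
  "aperiodic \<rho> \<longleftrightarrow> \<not> (\<exists>v. v \<noteq> [] \<and> fixed_point \<rho> (v\<^sup>\<omega>))"

definition column_group :: "('a \<Rightarrow> 'a list) \<Rightarrow> nat \<Rightarrow> ('a \<Rightarrow> 'a) monoid" where
  "column_group \<rho> L = subgroup_generated (BijGroup UNIV) (column \<rho> ` {..<L})"

text \<open>Meant for \<open>d \<ge> 1\<close>.\<close>

definition max_progression :: "'a word \<Rightarrow> nat \<Rightarrow> enat" where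
  "max_progression w d = Sup {enat M | M. \<exists>j. \<forall>n<M. w j = w (j + d * n)}"

lemma length_subst_list:
  assumes "substitution \<rho>"
  shows "length u \<le> length (subst_list \<rho> u)"
proof (induction u)
  case (Cons a u)
  have "length (\<rho> a) \<ge> 1"
    using assms by (auto simp: substitution_def Suc_le_eq)
  with Cons show ?case by (simp add: subst_list_def)
qed (simp add: subst_list_def)

lemma subst_list_append: "subst_list \<rho> (u @ v) = subst_list \<rho> u @ subst_list \<rho> v"
  by (simp add: subst_list_def)

lemma subst_list_prefix_nth:
  assumes "m \<le> n" "i < length (subst_list \<rho> (prefix m w))"
  shows "subst_list \<rho> (prefix n w) ! i = subst_list \<rho> (prefix m w) ! i"
proof -
  obtain k where "n = m + k" using assms(1) le_Suc_ex by blast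
  then show ?thesis
    using assms(2) by (simp only: subsequence_append subst_list_append nth_append if_True)
qed

lemma prefix_subst_word:
  assumes "substitution \<rho>"
  shows "prefix (length (subst_list \<rho> (prefix n w))) (subst_word \<rho> w) = subst_list \<rho> (prefix n w)"
proof (rule nth_equalityI)
  fix i assume "i < length (prefix (length (subst_list \<rho> (prefix n w))) (subst_word \<rho> w))"
  then have i: "i < length (subst_list \<rho> (prefix n w))" by (simp add: subsequence_def)
  have i': "i < length (subst_list \<rho> (prefix (Suc i) w))"
    using length_subst_list[OF assms, of "prefix (Suc i) w"] by (simp add: subsequence_def)
  have "subst_list \<rho> (prefix (Suc i) w) ! i = subst_list \<rho> (prefix n w) ! i"
    using subst_list_prefix_nth[OF _ i, of "Suc i"] subst_list_prefix_nth[OF _ i', of n]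
    by (metis nle_le)
  with i show "prefix (length (subst_list \<rho> (prefix n w))) (subst_word \<rho> w) ! i
      = subst_list \<rho> (prefix n w) ! i"
    by (simp add: subsequence_def subst_word_def)
qed (simp add: subsequence_def)

end

theory Submission
  imports Defs "HOL-Algebra.Multiplicative_Group"
begin

text \<open>
  Letter \<open>r\<close> of \<open>\<rho>\<^sup>n(a)\<close> is \<open>f a\<close> for a product \<open>f \<in> G\<close> of \<open>n\<close> columns, and a fixed point satisfies
  \<open>w (L^n * m + r) = f (w m)\<close>. For \<open>r < L^k\<close> the base-\<open>L^k\<close> digits of
  \<open>r * (1 + L^k + \<dots> + L^(k * (|G| - 1)))\<close> are \<open>|G|\<close> copies of \<open>r\<close>, so the letter of \<open>w\<close> at that position
  is \<open>(f ^^ |G|) (w 0) = w 0\<close>; this gives the lower bound.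

  Conversely, let \<open>w\<close> be constant on a long progression of difference \<open>d\<close>, and let \<open>L^K > d\<close>. The
  progression meets each block \<open>[q * L^K, (q + 1) * L^K)\<close> in its range, and it meets block \<open>q + d\<close> at
  the same offset as block \<open>q\<close>. As columns are injective, \<open>w q = w (q + d)\<close>. Hence \<open>w\<close> has
  arbitrarily long \<open>d\<close>-periodic factors; by primitivity they contain every prefix of \<open>w\<close>, so \<open>w\<close> is
  \<open>d\<close>-periodic.
\<close>

section \<open>Columns of the powers of a substitution, and fixed points at scale
  \<open>L ^ n\<close>\<close>

definition power_column :: "('a \<Rightarrow> 'a list) \<Rightarrow> nat \<Rightarrow> nat \<Rightarrow> 'a \<Rightarrow> 'a" where
  "power_column \<rho> n r = (\<lambda>a. (subst_list \<rho> ^^ n) [a] ! r)"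

lemma length_subst_list_constant:
  assumes "constant_length \<rho> L"
  shows "length (subst_list \<rho> u) = L * length u"
  using assms by (induction u) (auto simp: subst_list_def constant_length_def)

lemma length_subst_list_funpow:
  assumes "constant_length \<rho> L"
  shows "length ((subst_list \<rho> ^^ n) u) = L ^ n * length u"
  by (induction n) (simp_all add: length_subst_list_constant[OF assms])

lemma nth_subst_list:
  assumes "constant_length \<rho> L" "q < length u" "i < L"
  shows "subst_list \<rho> u ! (L * q + i) = column \<rho> i (u ! q)"
  using assms(2)
proof (induction u arbitrary: q)
  case (Cons a u)
  have len: "length (\<rho> a) = L"
    using assms(1) by (simp add: constant_length_def)
  show ?case
  proof (cases q)
    case 0
    then show ?thesis
      using len assms(3) by (simp add: subst_list_def nth_append column_def)
  next
    case (Suc p)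
    then show ?thesis
      using Cons.IH[of p] Cons.prems len by (simp add: subst_list_def nth_append)
  qed
qed simp

lemma power_column_0: "power_column \<rho> 0 0 = id"
  by (simp add: power_column_def fun_eq_iff)

lemma power_column_Suc:
  assumes "constant_length \<rho> L" "q < L ^ n" "i < L"
  shows "power_column \<rho> (Suc n) (L * q + i) = column \<rho> i \<circ> power_column \<rho> n q"
  using nth_subst_list[OF assms(1) _ assms(3)] length_subst_list_funpow[OF assms(1)] assms(2)
  by (simp add: power_column_def fun_eq_iff)

text \<open>Induction on the \<open>n\<close> base-\<open>L\<close> digits of \<open>r\<close>,
  leading zeros allowed: the lowest digit \<open>i\<close> is split off, which is the shape of
  \<open>power_column_Suc\<close>.\<close>

lemma digit_induct [consumes 2, case_names 0 Suc]:
  fixes L :: nat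
  assumes "L > 0" "r < L ^ n"
    and "P 0 0"
    and "\<And>n q i. q < L ^ n \<Longrightarrow> i < L \<Longrightarrow> P n q \<Longrightarrow> P (Suc n) (L * q + i)"
  shows "P n r"
  using assms(2)
proof (induction n arbitrary: r)
  case 0
  then show ?case using assms(3) by simp
next
  case (Suc n)
  have q: "r div L < L ^ n"
    using Suc.prems assms(1) by (simp add: less_mult_imp_div_less mult.commute)
  have i: "r mod L < L" using assms(1) by simp
  show ?case
    using assms(4)[OF q i Suc.IH[OF q]] by simp
qed

lemma bij_power_column:
  assumes "bijective_subst \<rho> L" "L > 0" "r < L ^ n"
  shows "bij (power_column \<rho> n r)"
proof -
  have cl: "constant_length \<rho> L" using assms(1) by (simp add: bijective_subst_def)
  from assms(2,3) show ?thesis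
  proof (induction rule: digit_induct)
    case 0
    show ?case by (simp only: power_column_0 bij_id)
  next
    case (Suc n q i)
    then show ?case
      using assms(1)
      by (simp only: power_column_Suc[OF cl] bijective_subst_def bij_comp)
  qed
qed

lemma fixed_point_nth:
  assumes "constant_length \<rho> L" "fixed_point \<rho> w" "i < L"
  shows "w (L * m + i) = column \<rho> i (w m)"
proof -
  have "m \<le> L * m" using assms(3) by (cases L) auto
  then have "m < Suc (L * m + i)" by linarith
  then have len: "m < length (prefix (Suc (L * m + i)) w)"
    by (simp only: subsequence_length diff_zero)
  have "w (L * m + i) = subst_list \<rho> (prefix (Suc (L * m + i)) w) ! (L * m + i)"
    using assms(2) unfolding fixed_point_def subst_word_def by metis
  also have "\<dots> = column \<rho> i (prefix (Suc (L * m + i)) w ! m)"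
    by (rule nth_subst_list[OF assms(1) len assms(3)])
  also have "prefix (Suc (L * m + i)) w ! m = w m"
    using len by (simp add: subsequence_def del: upt_Suc)
  finally show ?thesis .
qed

lemma fixed_point_power_nth:
  assumes "constant_length \<rho> L" "fixed_point \<rho> w" "L > 0" "r < L ^ n"
  shows "w (L ^ n * m + r) = power_column \<rho> n r (w m)"
  using assms(3,4)
proof (induction arbitrary: m rule: digit_induct)
  case 0
  then show ?case by (simp add: power_column_0)
next
  case (Suc n q i)
  have "L ^ Suc n * m + (L * q + i) = L * (L ^ n * m + q) + i"
    by (simp add: algebra_simps)
  then show ?case
    using Suc fixed_point_nth[OF assms(1,2)] power_column_Suc[OF assms(1)] by (simp only: o_apply)
qed

section \<open>The group generated by the columns\<close>

lemma mult_BijGroup_UNIV: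
  assumes "bij f" "bij g"
  shows "f \<otimes>\<^bsub>BijGroup UNIV\<^esub> g = f \<circ> g"
  using assms by (simp add: BijGroup_def Bij_def compose_def fun_eq_iff)

lemma carrier_BijGroup_UNIV: "carrier (BijGroup UNIV) = Collect bij"
  by (auto simp: BijGroup_def Bij_def)

lemma one_BijGroup_UNIV: "\<one>\<^bsub>BijGroup UNIV\<^esub> = id"
  by (simp add: BijGroup_def fun_eq_iff)

lemma pow_BijGroup_UNIV:
  assumes "bij f"
  shows "f [^]\<^bsub>BijGroup UNIV\<^esub> n = f ^^ n"
proof (induction n)
  case 0
  then show ?case by (simp add: one_BijGroup_UNIV)
next
  case (Suc n)
  then show ?case
    using mult_BijGroup_UNIV[OF bij_betw_funpow[OF assms, of n] assms]
    by (simp add: funpow_Suc_right del: funpow.simps)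
qed

lemma power_column_in_column_group:
  assumes "bijective_subst \<rho> L" "L > 0" "r < L ^ n"
  shows "power_column \<rho> n r \<in> carrier (column_group \<rho> L)"
proof -
  let ?B = "BijGroup (UNIV :: 'a set)"
  have cl: "constant_length \<rho> L" using assms(1) by (simp add: bijective_subst_def)
  interpret G: group "column_group \<rho> L"
    unfolding column_group_def by (intro group.group_subgroup_generated group_BijGroup)
  from assms(2,3) show ?thesis
  proof (induction rule: digit_induct)
    case 0
    show ?case
      using G.one_closed
      by (simp only: column_group_def one_subgroup_generated one_BijGroup_UNIV power_column_0)
  next
    case (Suc n q i)
    have bij: "bij (column \<rho> i)"
      using assms(1) Suc by (simp add: bijective_subst_def)
    then have "column \<rho> i \<in> carrier ?B \<inter> column \<rho> ` {..<L}"
      using Suc by (simp add: carrier_BijGroup_UNIV)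
    then have "column \<rho> i \<in> carrier (column_group \<rho> L)"
      unfolding column_group_def carrier_subgroup_generated by (rule generate.incl)
    then have "column \<rho> i \<otimes>\<^bsub>column_group \<rho> L\<^esub> power_column \<rho> n q \<in> carrier (column_group \<rho> L)"
      using Suc by simp
    then show ?case
      using mult_BijGroup_UNIV[OF bij bij_power_column[OF assms(1,2) \<open>q < L ^ n\<close>]] Suc
      by (simp only: column_group_def power_column_Suc[OF cl] mult_subgroup_generated)
  qed
qed

text \<open>Lagrange's theorem in the column group, with its powers read as iterates of
  maps.\<close>

lemma power_column_funpow_order:
  fixes \<rho> :: "'a::finite \<Rightarrow> 'a list"
  assumes "bijective_subst \<rho> L" "L > 0" "r < L ^ n"
  shows "power_column \<rho> n r ^^ order (column_group \<rho> L) = id"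
proof -
  interpret G: group "column_group \<rho> L"
    unfolding column_group_def by (intro group.group_subgroup_generated group_BijGroup)
  have "power_column \<rho> n r [^]\<^bsub>column_group \<rho> L\<^esub> order (column_group \<rho> L) = \<one>\<^bsub>column_group \<rho> L\<^esub>"
    by (intro G.pow_order_eq_1 power_column_in_column_group assms)
  then show ?thesis
    using pow_BijGroup_UNIV[OF bij_power_column[OF assms]]
    by (simp add: column_group_def pow_subgroup_generated one_BijGroup_UNIV)
qed

section \<open>Lower bound\<close>

text \<open>The index has \<open>s\<close> base-\<open>L ^ k\<close> digits, all equal to
  \<open>r\<close>; removing the lowest one costs one application of
  \<open>power_column \<rho> k r\<close>.\<close>

lemma fixed_point_repeated_digit:
  assumes "constant_length \<rho> L" "fixed_point \<rho> w" "L > 0" "r < L ^ k"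
  shows "w (r * (\<Sum>i<s. (L ^ k) ^ i)) = (power_column \<rho> k r ^^ s) (w 0)"
proof (induction s)
  case (Suc s)
  have "(\<Sum>i<Suc s. (L ^ k) ^ i) = 1 + L ^ k * (\<Sum>i<s. (L ^ k) ^ i)"
    by (simp add: sum.lessThan_Suc_shift sum_distrib_left del: sum.lessThan_Suc)
  then have "r * (\<Sum>i<Suc s. (L ^ k) ^ i) = L ^ k * (r * (\<Sum>i<s. (L ^ k) ^ i)) + r"
    by (simp only: algebra_simps)
  then show ?case
    using fixed_point_power_nth[OF assms] Suc by simp
qed simp

lemma geometric_sum_nat:
  fixes x :: nat
  assumes "x \<ge> 2"
  shows "(x ^ n - 1) div (x - 1) = (\<Sum>i<n. x ^ i)"
proof -
  \<comment> \<open>The detour through the integers avoids truncated subtraction.\<close>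
  have "int (x ^ n - 1) = int ((x - 1) * (\<Sum>i<n. x ^ i))"
    using assms power_diff_1_eq[of "int x" n] by (simp add: of_nat_diff)
  then have "x ^ n - 1 = (x - 1) * (\<Sum>i<n. x ^ i)"
    by (simp only: of_nat_eq_iff)
  then show ?thesis using assms by simp
qed

lemma max_progression_lower_bound:
  fixes \<rho> :: "'a::finite \<Rightarrow> 'a list"
  assumes "bijective_subst \<rho> L" "fixed_point \<rho> w" "L > 0"
  shows "enat (L ^ k) \<le> max_progression w (\<Sum>i<order (column_group \<rho> L). (L ^ k) ^ i)"
proof -
  let ?d = "\<Sum>i<order (column_group \<rho> L). (L ^ k) ^ i"
  have cl: "constant_length \<rho> L" using assms(1) by (simp add: bijective_subst_def)
  \<comment> \<open>The progression starts at \<open>j = 0\<close>, and its term number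
    \<open>r\<close> is the position with repeated digit \<open>r\<close>.\<close>
  have "w 0 = w (0 + ?d * r)" if "r < L ^ k" for r
    using fixed_point_repeated_digit[OF cl assms(2,3) that, of "order (column_group \<rho> L)"]
      power_column_funpow_order[OF assms(1,3) that]
    by (simp add: mult.commute)
  then show ?thesis
    unfolding max_progression_def by (intro Sup_upper) blast
qed

section \<open>Finiteness\<close>

text \<open>Each aligned block of length \<open>L ^ n\<close> in \<open>w\<close> is the image of
  one letter under the \<open>n\<close>-th power, which for a suitable \<open>n\<close> contains all
  letters.\<close>

lemma primitive_recurrent:
  assumes "constant_length \<rho> L" "fixed_point \<rho> w" "L > 0" "primitive \<rho>"
  obtains n where "\<And>m a. \<exists>q<L ^ n. w (L ^ n * m + q) = a"
proof -
  obtain n where n: "\<And>a. set ((subst_list \<rho> ^^ n) [a]) = UNIV"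
    using assms(4) by (auto simp: primitive_def)
  have "\<exists>q<L ^ n. w (L ^ n * m + q) = a" for m a
  proof -
    have "a \<in> set ((subst_list \<rho> ^^ n) [w m])" using n by simp
    then obtain q where "q < L ^ n" "(subst_list \<rho> ^^ n) [w m] ! q = a"
      by (auto simp: in_set_conv_nth length_subst_list_funpow[OF assms(1)])
    then show ?thesis
      using fixed_point_power_nth[OF assms(1-3)] by (auto simp: power_column_def)
  qed
  then show thesis using that by blast
qed

lemma aperiodic_fixed_point:
  assumes "aperiodic \<rho>" "fixed_point \<rho> w" "d \<ge> 1"
  obtains t where "w t \<noteq> w (t + d)"
proof -
  have "\<exists>t. w t \<noteq> w (t + d)"
  proof (rule ccontr)
    assume "\<not> ?thesis"
    then have step: "w (t + d) = w t" for t by metis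
    have shift: "w (t + d * s) = w t" for t s
    proof (induction s)
      case (Suc s)
      then show ?case using step[of "t + d * s"] by (simp add: ac_simps)
    qed simp
    have "w t = w (t mod d)" for t
      using shift[of "t mod d" "t div d"] by simp
    then have "(prefix d w)\<^sup>\<omega> = w"
      using assms(3) by (auto simp: iter_def subsequence_def fun_eq_iff)
    moreover have "prefix d w \<noteq> []" using assms(3) by (simp add: subsequence_def)
    ultimately show False using assms(1,2) by (metis aperiodic_def)
  qed
  then show thesis using that by blast
qed

text \<open>For \<open>L = 1\<close> the blocks of \<open>primitive_recurrent\<close> are single
  letters, so \<open>w\<close> would be constant.\<close>

lemma aperiodic_length_ge_2:
  assumes "constant_length \<rho> L" "substitution \<rho>" "primitive \<rho>" "aperiodic \<rho>" "fixed_point \<rho> w"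
  shows "L \<ge> 2"
proof (rule ccontr)
  assume "\<not> L \<ge> 2"
  moreover have "L \<noteq> 0"
    using assms(1,2) by (auto simp: constant_length_def substitution_def)
  ultimately have L: "L = 1" by simp
  obtain n where "\<And>m a. \<exists>q<L ^ n. w (L ^ n * m + q) = a"
    using primitive_recurrent[OF assms(1,5) _ assms(3)] L by auto
  then have "w m = a" for m a using L by simp
  moreover obtain t where "w t \<noteq> w (t + 1)"
    using aperiodic_fixed_point[OF assms(4,5), of 1] by auto
  ultimately show False by metis
qed

text \<open>The \<open>N + 1\<close> blocks after the one containing \<open>j\<close> are treated.
  Reaching the last of them takes at most \<open>L ^ K * (N + 1) + 1\<close> steps, and
  \<open>L ^ K\<close> further steps lead to the block \<open>d\<close> places later;
  \<open>L ^ K * (N + 3)\<close> terms cover both.\<close>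

lemma progression_imp_periodic_factor:
  assumes "bijective_subst \<rho> L" "fixed_point \<rho> w" "d \<ge> 1" "d < L ^ K"
    and prog: "\<And>n. n < L ^ K * (N + 3) \<Longrightarrow> w j = w (j + d * n)"
    and q: "j div L ^ K < q" "q \<le> j div L ^ K + N + 1"
  shows "w q = w (q + d)"
proof -
  have cl: "constant_length \<rho> L" using assms(1) by (simp add: bijective_subst_def)
  let ?B = "L ^ K"
  have B: "?B > 0" using assms(4) by linarith
  have L: "L > 0"
    using assms(3,4) by (intro Nat.gr0I) (cases K; simp)
  define X where "X = ?B * q - j"
  have "j < ?B * q"
    using q(1) B by (simp add: div_less_iff_less_mult mult.commute)
  then have X: "?B * q = j + X" by (simp add: X_def)
  have "?B * q \<le> ?B * (j div ?B + N + 1)" using q(2) by (rule mult_le_mono2)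
  also have "\<dots> = ?B * (j div ?B) + ?B * (N + 1)" by (simp add: algebra_simps)
  also have "\<dots> \<le> j + ?B * (N + 1)" by simp
  finally have X_le: "X \<le> ?B * (N + 1)" using X by linarith
  \<comment> \<open>The least \<open>s\<close> with \<open>d * s > X\<close>: the first term
    strictly beyond the start of block \<open>q\<close>. It overshoots by at most
    \<open>d < L ^ K\<close>, so it stays in that block.\<close>
  define s where "s = X div d + 1"
  have s: "X < d * s" "d * s \<le> X + d"
    using assms(3) dividend_less_times_div[of d X] by (simp_all add: s_def)
  define r where "r = d * s - X"
  have r: "d * s = X + r" "r < ?B" using s assms(4) by (simp_all add: r_def)
  have "s \<le> X + 1" by (simp add: s_def)
  then have s_less: "s + ?B < ?B * (N + 3)"
    using X_le assms(3,4) by (simp add: algebra_simps)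
  have "power_column \<rho> K r (w q) = w (?B * q + r)"
    using fixed_point_power_nth[OF cl assms(2) L r(2)] by simp
  also have "?B * q + r = j + d * s" using X r(1) by simp
  also have "w (j + d * s) = w j" using prog[of s] s_less by simp
  \<comment> \<open>Another \<open>L ^ K\<close> terms advance by \<open>d * L ^ K\<close>, that is,
    by \<open>d\<close> whole blocks, and keep the offset \<open>r\<close>.\<close>
  also have "w j = w (j + d * (s + ?B))" using prog[OF s_less] .
  also have "j + d * (s + ?B) = ?B * (q + d) + r" using X r(1) by (simp add: algebra_simps)
  also have "w (?B * (q + d) + r) = power_column \<rho> K r (w (q + d))"
    using fixed_point_power_nth[OF cl assms(2) L r(2)] .
  finally show ?thesis
    using bij_power_column[OF assms(1) L r(2)] by (simp add: bij_def inj_eq)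
qed

lemma max_progression_finite:
  assumes "substitution \<rho>" "bijective_subst \<rho> L" "primitive \<rho>" "aperiodic \<rho>" "fixed_point \<rho> w"
    and d: "d \<ge> 1"
  shows "max_progression w d < \<infinity>"
proof -
  have cl: "constant_length \<rho> L" using assms(2) by (simp add: bijective_subst_def)
  have L2: "L \<ge> 2" by (rule aperiodic_length_ge_2[OF cl assms(1,3-5)])
  then have L: "L > 0" by simp
  obtain t where t: "w t \<noteq> w (t + d)" using aperiodic_fixed_point[OF assms(4,5) d] .
  obtain n where n: "\<And>m a. \<exists>q<L ^ n. w (L ^ n * m + q) = a"
    using primitive_recurrent[OF cl assms(5) L assms(3)] by blast
  have gt: "i < L ^ i" for i using L2 by (simp add: power_gt_expt)
  \<comment> \<open>The prefix of \<open>w\<close> up to index \<open>T\<close> contains the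
    mismatch at \<open>t\<close> and \<open>t + d\<close>.\<close>
  define T where "T = t + d"
  \<comment> \<open>The bound of \<open>progression_imp_periodic_factor\<close> for
    \<open>K = d\<close> and \<open>N = 2 * L ^ (n + T)\<close>; a window that long contains a whole
    aligned block of length \<open>L ^ (n + T)\<close>.\<close>
  define B where "B = L ^ d * (2 * L ^ (n + T) + 3)"
  have "M \<le> B" if prog: "\<forall>i<M. w j = w (j + d * i)" for M j
  proof (rule ccontr)
    assume "\<not> M \<le> B"
    then have per: "w q = w (q + d)"
      if "j div L ^ d < q" "q \<le> j div L ^ d + 2 * L ^ (n + T) + 1" for q
      using progression_imp_periodic_factor[OF assms(2,5) d gt _ that] prog
      by (simp add: B_def)
    \<comment> \<open>The first such block that starts after \<open>j div L ^ d\<close>.\<close>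
    define m where "m = j div L ^ d div L ^ (n + T) + 1"
    obtain q where q: "q < L ^ n" "w (L ^ n * m + q) = w 0" using n by blast
    \<comment> \<open>The \<open>T\<close>-th power of \<open>\<rho>\<close> sends this occurrence
      of \<open>w 0\<close> to a copy at \<open>p\<close> of the first \<open>L ^ T > T\<close>
      letters of \<open>w\<close>, mismatch included.\<close>
    define p where "p = L ^ T * (L ^ n * m + q)"
    have w_p: "w (p + i) = w i" if "i \<le> T" for i
    proof -
      have i: "i < L ^ T" using gt[of T] that by simp
      show ?thesis
        using fixed_point_power_nth[OF cl assms(5) L i, of "L ^ n * m + q"]
          fixed_point_power_nth[OF cl assms(5) L i, of 0] q(2) by (simp add: p_def)
    qed
    have p: "p = L ^ (n + T) * m + L ^ T * q"
      by (simp add: p_def power_add algebra_simps)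
    have "L ^ T * (q + 1) \<le> L ^ T * L ^ n" using q(1) by (intro mult_le_mono2) simp
    moreover have "t < L ^ T" using gt[of T] by (simp add: T_def)
    ultimately have "L ^ T * q + t < L ^ (n + T)"
      by (simp add: power_add algebra_simps)
    moreover have "j div L ^ d < L ^ (n + T) * m"
      using L by (simp add: m_def dividend_less_times_div)
    moreover have "L ^ (n + T) * m \<le> j div L ^ d + L ^ (n + T)"
      by (simp add: m_def)
    ultimately have "w (p + t) = w (p + t + d)" by (intro per) (simp_all add: p)
    then show False using w_p[of t] w_p[of "t + d"] t by (simp add: T_def add.assoc)
  qed
  then have "max_progression w d \<le> enat B"
    unfolding max_progression_def by (intro Sup_least) auto
  then show ?thesis by (rule order.strict_trans1) simp
qed

theorem proposition8:
  fixes \<rho> :: "'a::finite \<Rightarrow> 'a list" and L k :: nat and w :: "'a word"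
  assumes "substitution \<rho>"
    and "constant_length \<rho> L"
    and "bijective_subst \<rho> L"
    and "primitive \<rho>"
    and "aperiodic \<rho>"
    and "column \<rho> 0 = id"
    and "fixed_point \<rho> w"
    and "k \<ge> 1"
  shows "enat (L ^ k) \<le> max_progression w
            ((L ^ (k * order (column_group \<rho> L)) - 1) div (L ^ k - 1))
       \<and> max_progression w
            ((L ^ (k * order (column_group \<rho> L)) - 1) div (L ^ k - 1)) < \<infinity>"
proof -
  let ?g = "order (column_group \<rho> L)"
  interpret G: group "column_group \<rho> L"
    unfolding column_group_def by (intro group.group_subgroup_generated group_BijGroup)
  have L2: "L \<ge> 2" by (rule aperiodic_length_ge_2[OF assms(2,1,4,5,7)])
  have "L ^ 1 \<le> L ^ k" using L2 assms(8) by (intro power_increasing) auto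
  then have "L ^ k \<ge> 2" using L2 by simp
  then have d: "(L ^ (k * ?g) - 1) div (L ^ k - 1) = (\<Sum>i<?g. (L ^ k) ^ i)"
    using geometric_sum_nat[of "L ^ k" ?g] by (simp add: power_mult)
  \<comment> \<open>A nonempty sum makes the difference at least 1, as the finiteness result
    requires.\<close>
  have "?g > 0" by (simp add: G.order_gt_0_iff_finite)
  then have "(\<Sum>i<?g. (L ^ k) ^ i) \<ge> (L ^ k) ^ 0" by (intro member_le_sum) auto
  then show ?thesis
    unfolding d
    using max_progression_lower_bound[OF assms(3,7)] max_progression_finite[OF assms(1,3-5,7)] L2
    by simp
qed

end
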